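(* Let $H_4$ be the Nappi-Witten Lie algebra with Cartan subalgebra $\mathfrak h=\mathbb C s$. Then: (1) Up to isomorphism, $\mathcal M(H_4,\mathfrak h)=\{M_{(g,0)},\,M_{(0,g)},\,M_{(h,b)},\,M_{(b,h)},\,M_{(a,b)},\,M_0 : g,h\in\mathbb C[s],\ a,b\in\mathbb C^*,\ \deg(h)=1\}$; that is, each of these is an $H_4$-module belonging to $\mathcal M(H_4,\mathfrak h)$, and every object of $\mathcal M(H_4,\mathfrak h)$ is isomorphic to one of them. (2) For $g\in\mathbb C[s]$, the module $M_{(g,0)}$ is irreducible if and only if $g$ is a non-zero constant polynomial, and likewise $M_{(0,g)}$ is irreducible if and only if $g$ is a non-zero constant polynomial. (3) For all $a,b\in\mathbb C^*$ and all $h\in\mathbb C[s]$ with $\deg(h)=1$, the modules $M_{(h,b)}$, $M_{(b,h)}$ and $M_{(a,b)}$ are irreducible.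
   Context: $\mathbb C^*=\mathbb C\setminus\{0\}$; everything is over $\mathbb C$. The Nappi-Witten Lie algebra is $H_4=\mathbb C p\oplus\mathbb C q\oplus\mathbb C r\oplus\mathbb C s$ with brackets $[p,q]=r$, $[s,p]=p$, $[s,q]=-q$, $[r,\cdot]=0$. Put $\mathfrak h=\mathbb C s$, so $U(\mathfrak h)=\mathbb C[s]$. $\mathcal M(H_4,\mathfrak h)$ is the category of $U(H_4)$-modules whose restriction to $U(\mathfrak h)$ is free of rank $1$. Let $\tau$ be the algebra automorphism of $\mathbb C[s]$ with $\tau(s)=s-1$. Each of the following modules has underlying space $\mathbb C[s]$, with $s.x=sx$ for $x\in\mathbb C[s]$, and the remaining actions: - $M_{(g,0)}$, $g\in\mathbb C[s]$: $p.x=\tau(x)g$, $q.x=0$, $r.x=0$. - $M_{(0,g)}$, $g\in\mathbb C[s]$: $p.x=0$, $q.x=\tau^{-1}(x)g$, $r.x=0$. - $M_{(h,b)}$, $h(s)=a_1s+a_2$ of degree one ($a_1\in\mathbb C^*$, $a_2\in\mathbb C$), $b\in\mathbb C^*$: $p.x=\tau(x)h(s)$, $q.x=\tau^{-1}(x)b$, $r.x=-a_1b\,x$. - $M_{(b,h)}$, same $h,b$: $p.x=\tau(x)b$, $q.x=\tau^{-1}(x)h(s)$, $r.x=-a_1b\,x$. - $M_{(a,b)}$, $a,b\in\mathbb C^*$: $p.x=\tau(x)a$, $q.x=\tau^{-1}(x)b$, $r.x=0$. - $M_0$: $p.x=q.x=r.x=0$. *)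

theory Defs
  imports "HOL-Analysis.Analysis" "HOL-Computational_Algebra.Polynomial"
begin

section \<open>Lie algebras and their modules\<close>

locale lie_algebra = vector_space scl
  for scl :: "'k::field \<Rightarrow> 'l::ab_group_add \<Rightarrow> 'l" +
  fixes bracket :: "'l \<Rightarrow> 'l \<Rightarrow> 'l"
  assumes bracket_linear_left: "Vector_Spaces.linear scl scl (\<lambda>x. bracket x y)"
    and bracket_linear_right: "Vector_Spaces.linear scl scl (\<lambda>y. bracket x y)"
    and bracket_self: "bracket x x = 0"
    and jacobi: "bracket x (bracket y z) + bracket y (bracket z x) + bracket z (bracket x y) = 0"

text \<open>
  A left module over the universal enveloping algebra of a Lie algebra is the same thing as a
  vector space with a bilinear action of the Lie algebra that turns brackets into commutators.
  Submodules and homomorphisms are the same in both descriptions.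
\<close>

locale lie_module = lie_algebra scaleL bracket + V: vector_space scaleV
  for scaleL :: "'k::field \<Rightarrow> 'l::ab_group_add \<Rightarrow> 'l" and bracket
    and scaleV :: "'k \<Rightarrow> 'v::ab_group_add \<Rightarrow> 'v" +
  fixes act :: "'l \<Rightarrow> 'v \<Rightarrow> 'v"
  assumes act_linear_left: "Vector_Spaces.linear scaleL scaleV (\<lambda>x. act x v)"
    and act_linear_right: "Vector_Spaces.linear scaleV scaleV (act x)"
    and act_bracket: "act (bracket x y) v = act x (act y v) - act y (act x v)"

definition lie_submodule ::
    "('k::field \<Rightarrow> 'v::ab_group_add \<Rightarrow> 'v) \<Rightarrow> ('l \<Rightarrow> 'v \<Rightarrow> 'v) \<Rightarrow> 'v set \<Rightarrow> bool" where
  "lie_submodule scaleV act W \<longleftrightarrow>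
     module.subspace scaleV W \<and> (\<forall>x. \<forall>w\<in>W. act x w \<in> W)"

definition module_isomorphic ::
    "('k::field \<Rightarrow> 'v::ab_group_add \<Rightarrow> 'v) \<Rightarrow> ('l \<Rightarrow> 'v \<Rightarrow> 'v) \<Rightarrow>
     ('k \<Rightarrow> 'w::ab_group_add \<Rightarrow> 'w) \<Rightarrow> ('l \<Rightarrow> 'w \<Rightarrow> 'w) \<Rightarrow> bool" where
  "module_isomorphic scaleV actV scaleW actW \<longleftrightarrow>
     (\<exists>\<phi>. Vector_Spaces.linear scaleV scaleW \<phi> \<and> bij \<phi> \<and>
          (\<forall>x v. \<phi> (actV x v) = actW x (\<phi> v)))"

definition free_of_rank_one :: "('r::comm_ring_1 \<Rightarrow> 'v::ab_group_add \<Rightarrow> 'v) \<Rightarrow> bool" where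
  "free_of_rank_one scl \<longleftrightarrow> module scl \<and>
     (\<exists>v. \<not> module.dependent scl {v} \<and> module.span scl {v} = UNIV)"


section \<open>The Nappi-Witten Lie algebra\<close>

text \<open>The vector \<open>x\<close> stands for \<open>x$1 p + x$2 q + x$3 r + x$4 s\<close>.\<close>

type_synonym H4 = "complex ^ 4"

definition H4_p :: H4 where "H4_p = axis 1 1"
definition H4_q :: H4 where "H4_q = axis 2 1"
definition H4_r :: H4 where "H4_r = axis 3 1"
definition H4_s :: H4 where "H4_s = axis 4 1"

definition H4_bracket :: "H4 \<Rightarrow> H4 \<Rightarrow> H4" where
  "H4_bracket x y =
     (x$4 * y$1 - x$1 * y$4) *s H4_p - (x$4 * y$2 - x$2 * y$4) *s H4_q
     + (x$1 * y$2 - x$2 * y$1) *s H4_r"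

lemmas H4_basis_defs = H4_p_def H4_q_def H4_r_def H4_s_def

lemma H4_brackets:
  "H4_bracket H4_p H4_q = H4_r" "H4_bracket H4_s H4_p = H4_p" "H4_bracket H4_s H4_q = - H4_q"
  "H4_bracket H4_r x = 0"
  by (simp_all add: H4_bracket_def H4_basis_defs vec_eq_iff forall_4 axis_def)

lemma lie_algebra_H4: "lie_algebra (*s) H4_bracket"
  by unfold_locales
    (simp_all add: H4_bracket_def H4_basis_defs vec_eq_iff forall_4 axis_def algebra_simps)

abbreviation H4_module ::
    "(complex \<Rightarrow> 'v::ab_group_add \<Rightarrow> 'v) \<Rightarrow> (H4 \<Rightarrow> 'v \<Rightarrow> 'v) \<Rightarrow> bool" where
  "H4_module \<equiv> lie_module (*s) H4_bracket"

definition H4_irreducible ::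
    "(complex \<Rightarrow> 'v::ab_group_add \<Rightarrow> 'v) \<Rightarrow> (H4 \<Rightarrow> 'v \<Rightarrow> 'v) \<Rightarrow> bool" where
  "H4_irreducible scl act \<longleftrightarrow> H4_module scl act \<and> (UNIV :: 'v set) \<noteq> {0} \<and>
     (\<forall>W. lie_submodule scl act W \<longrightarrow> W = {0} \<or> W = UNIV)"

text \<open>
  The restriction to \<open>U(\<complex>s) = \<complex>[s]\<close>: a polynomial \<open>f(s)\<close> acts by substituting
  the operator by which \<open>s\<close> acts.
\<close>

definition Uh_scale ::
    "(complex \<Rightarrow> 'v::ab_group_add \<Rightarrow> 'v) \<Rightarrow> (H4 \<Rightarrow> 'v \<Rightarrow> 'v) \<Rightarrow> complex poly \<Rightarrow> 'v \<Rightarrow> 'v" where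
  "Uh_scale scl act f v = (\<Sum>i\<le>degree f. scl (coeff f i) ((act H4_s ^^ i) v))"

definition in_M_H4_h ::
    "(complex \<Rightarrow> 'v::ab_group_add \<Rightarrow> 'v) \<Rightarrow> (H4 \<Rightarrow> 'v \<Rightarrow> 'v) \<Rightarrow> bool" where
  "in_M_H4_h scl act \<longleftrightarrow> H4_module scl act \<and> free_of_rank_one (Uh_scale scl act)"


section \<open>The modules on \<open>\<complex>[s]\<close>\<close>

definition tau :: "complex poly \<Rightarrow> complex poly" where
  "tau x = pcompose x [:-1, 1:]"

definition tau_inv :: "complex poly \<Rightarrow> complex poly" where
  "tau_inv x = pcompose x [:1, 1:]"

lemma tau_inv_tau: "tau_inv (tau x) = x" and tau_tau_inv: "tau (tau_inv x) = x"
  by (simp_all add: tau_def tau_inv_def pcompose_assoc[symmetric] pcompose_pCons)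

text \<open>
  The linear action of \<open>H4\<close> on \<open>\<complex>[s]\<close> in which \<open>p\<close>, \<open>q\<close>, \<open>r\<close>
  act by the given operators and \<open>s\<close> acts by multiplication.
\<close>

definition H4_act ::
    "(complex poly \<Rightarrow> complex poly) \<Rightarrow> (complex poly \<Rightarrow> complex poly) \<Rightarrow>
     (complex poly \<Rightarrow> complex poly) \<Rightarrow> H4 \<Rightarrow> complex poly \<Rightarrow> complex poly" where
  "H4_act P Q R z x =
     smult (z$1) (P x) + smult (z$2) (Q x) + smult (z$3) (R x) + smult (z$4) ([:0, 1:] * x)"

lemma H4_act_generators:
  "H4_act P Q R H4_p x = P x" "H4_act P Q R H4_q x = Q x" "H4_act P Q R H4_r x = R x"
  "H4_act P Q R H4_s x = [:0, 1:] * x"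
  by (simp_all add: H4_act_def H4_basis_defs axis_def)

definition M_g0 :: "complex poly \<Rightarrow> H4 \<Rightarrow> complex poly \<Rightarrow> complex poly" where
  "M_g0 g = H4_act (\<lambda>x. tau x * g) (\<lambda>x. 0) (\<lambda>x. 0)"

definition M_0g :: "complex poly \<Rightarrow> H4 \<Rightarrow> complex poly \<Rightarrow> complex poly" where
  "M_0g g = H4_act (\<lambda>x. 0) (\<lambda>x. tau_inv x * g) (\<lambda>x. 0)"

text \<open>For \<open>h = a\<^sub>1 s + a\<^sub>2\<close>, the scalar \<open>a\<^sub>1\<close> is \<open>coeff h 1\<close>.\<close>

definition M_hb :: "complex poly \<Rightarrow> complex \<Rightarrow> H4 \<Rightarrow> complex poly \<Rightarrow> complex poly" where
  "M_hb h b = H4_act (\<lambda>x. tau x * h) (\<lambda>x. tau_inv x * [:b:]) (\<lambda>x. smult (- coeff h 1 * b) x)"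

definition M_bh :: "complex \<Rightarrow> complex poly \<Rightarrow> H4 \<Rightarrow> complex poly \<Rightarrow> complex poly" where
  "M_bh b h = H4_act (\<lambda>x. tau x * [:b:]) (\<lambda>x. tau_inv x * h) (\<lambda>x. smult (- coeff h 1 * b) x)"

definition M_ab :: "complex \<Rightarrow> complex \<Rightarrow> H4 \<Rightarrow> complex poly \<Rightarrow> complex poly" where
  "M_ab a b = H4_act (\<lambda>x. tau x * [:a:]) (\<lambda>x. tau_inv x * [:b:]) (\<lambda>x. 0)"

definition M_0 :: "H4 \<Rightarrow> complex poly \<Rightarrow> complex poly" where
  "M_0 = H4_act (\<lambda>x. 0) (\<lambda>x. 0) (\<lambda>x. 0)"

end

theory Submission imports Defs begin

text \<open>
  Let \<open>V\<close> be a module whose restriction to \<open>\<complex>[s]\<close> is free on one generator \<open>v\<close>. The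
  relations \<open>[s,p] = p\<close>, \<open>[s,q] = -q\<close> and \<open>[s,r] = 0\<close> allow \<open>p\<close>, \<open>q\<close>, \<open>r\<close> to be moved past every
  polynomial in \<open>s\<close>, at the price of a shift of the variable. The whole action is therefore
  determined by three polynomials \<open>A\<close>, \<open>B\<close>, \<open>R\<close> with \<open>p.v = A.v\<close>, \<open>q.v = B.v\<close>, \<open>r.v = R.v\<close>; in the
  coordinate \<open>\<complex>[s] \<cong> V\<close> given by \<open>v\<close> they act as \<open>p.x = \<tau>(x)A\<close>, \<open>q.x = \<tau>\<^bsup>-1\<^esup>(x)B\<close>, \<open>r.x = Rx\<close>. The
  relations \<open>[p,q] = r\<close> and \<open>[p,r] = 0\<close> become \<open>R = F - \<tau>\<^bsup>-1\<^esup>(F)\<close> with \<open>F = A\<tau>(B)\<close>, and \<open>A\<tau>(R) = AR\<close>.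

  Everything else follows from one fact about polynomials in characteristic \<open>0\<close>: a polynomial
  invariant under a nontrivial shift is constant (\<open>shift_invariant_imp_constant\<close>). It first
  shows that \<open>R\<close> is a constant \<open>c\<close> (if \<open>A = 0\<close>, then \<open>R = 0\<close>), which gives
  \<open>in_M_imp_rank_one_act\<close>. Applied to \<open>F + cs\<close>, which is invariant, it shows that \<open>F\<close> has degree
  at most one. Unless one of \<open>A\<close> and \<open>B\<close> vanishes, their degrees thus add up to at most one, and
  the listed families are exactly the possibilities (\<open>compatible_cases\<close>).

  Submodules are ideals of \<open>\<complex>[s]\<close>. If \<open>A\<close> or \<open>B\<close> is a nonzero constant, they are closed
  under a shift. For \<open>w\<close> of least degree in a nonzero ideal of this kind, the difference of \<open>w\<close> and
  its shift has smaller degree and hence vanishes, so \<open>w\<close> is constant and the ideal is everything.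
  Conversely, a common nonunit divisor \<open>d \<noteq> 0\<close> of \<open>A\<close> and \<open>B\<close> generates a proper nonzero submodule.
\<close>


section \<open>Shifts of polynomials\<close>

lemma tau_simps [simp]:
  "tau 0 = 0" "tau 1 = 1" "tau (x + y) = tau x + tau y" "tau (x - y) = tau x - tau y"
  "tau (smult c x) = smult c (tau x)" "tau (x * y) = tau x * tau y" "tau [:c:] = [:c:]"
  "tau (pCons c x) = [:c:] + [:-1, 1:] * tau x"
  by (simp_all add: tau_def pcompose_1 pcompose_add pcompose_diff pcompose_smult pcompose_mult pcompose_pCons)

lemma tau_inv_simps [simp]:
  "tau_inv 0 = 0" "tau_inv 1 = 1" "tau_inv (x + y) = tau_inv x + tau_inv y"
  "tau_inv (x - y) = tau_inv x - tau_inv y"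
  "tau_inv (smult c x) = smult c (tau_inv x)" "tau_inv (x * y) = tau_inv x * tau_inv y"
  "tau_inv [:c:] = [:c:]"
  "tau_inv (pCons c x) = [:c:] + [:1, 1:] * tau_inv x"
  by (simp_all add: tau_inv_def pcompose_1 pcompose_add pcompose_diff pcompose_smult pcompose_mult
      pcompose_pCons)

declare tau_inv_tau [simp] tau_tau_inv [simp]

lemma degree_shift [simp]: "degree (tau x) = degree x" "degree (tau_inv x) = degree x"
  by (simp_all add: tau_def tau_inv_def degree_pcompose)

lemma shift_eq_0_iff [simp]: "tau x = 0 \<longleftrightarrow> x = 0" "tau_inv x = 0 \<longleftrightarrow> x = 0"
  by (simp_all add: tau_def tau_inv_def pcompose_eq_0_iff)

text \<open>
  An invariant polynomial takes the value \<open>f(0)\<close> at all the points \<open>nc\<close>. In characteristic \<open>0\<close>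
  these are infinitely many, so \<open>f - f(0)\<close> has too many roots.
\<close>

lemma shift_invariant_imp_constant:
  fixes f :: "'a::field_char_0 poly"
  assumes "pcompose f [:c, 1:] = f" and "c \<noteq> 0"
  shows "degree f = 0"
proof (rule ccontr)
  assume "degree f \<noteq> 0"
  define g where "g = f - [:poly f 0:]"
  have step: "poly f (c + x) = poly f x" for x
    using arg_cong[OF assms(1), of "\<lambda>h. poly h x"] by (simp add: poly_pcompose)
  have orbit: "poly f (of_nat n * c) = poly f 0" for n
  proof (induction n)
    case (Suc n)
    then show ?case using step[of "of_nat n * c"] by (simp add: algebra_simps)
  qed simp
  have "g \<noteq> 0" using \<open>degree f \<noteq> 0\<close> unfolding g_def
    by (metis degree_pCons_0 eq_iff_diff_eq_0)
  then have "finite {x. poly g x = 0}" by (rule poly_roots_finite)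
  moreover have "range (\<lambda>n. of_nat n * c) \<subseteq> {x. poly g x = 0}"
    by (auto simp: g_def orbit)
  moreover have "inj (\<lambda>n. of_nat n * c)"
    using \<open>c \<noteq> 0\<close> by (auto simp: inj_def)
  ultimately show False by (meson finite_subset range_inj_infinite)
qed

text \<open>
  A shift preserves the leading coefficient, which therefore cancels in the difference.
\<close>

lemma degree_shift_diff_less:
  fixes f :: "'a::field_char_0 poly"
  assumes "degree f > 0"
  shows "degree (pcompose f [:c, 1:] - f) < degree f"
proof -
  have "degree (pcompose f [:c, 1:]) = degree f" by (simp add: degree_pcompose)
  moreover have "lead_coeff (pcompose f [:c, 1:]) = lead_coeff f"
    by (subst lead_coeff_comp) auto
  ultimately have "coeff (pcompose f [:c, 1:] - f) (degree f) = 0"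
    by simp
  moreover have "degree (pcompose f [:c, 1:] - f) \<le> degree f"
    by (intro degree_diff_le) (auto simp: degree_pcompose)
  ultimately show ?thesis
    using assms by (metis le_neq_implies_less leading_coeff_0_iff degree_0)
qed

text \<open>
  Behind every irreducibility claim: a nonzero element \<open>w\<close> of least degree must be shift invariant,
  since its difference with its own shift is again in \<open>W\<close> and of smaller degree.
\<close>

lemma shift_closed_ideal_trivial:
  fixes W :: "'a::field_char_0 poly set"
  assumes c: "c \<noteq> 0"
    and W0: "w0 \<in> W" "w0 \<noteq> 0"
    and diff: "\<And>x y. x \<in> W \<Longrightarrow> y \<in> W \<Longrightarrow> x - y \<in> W"
    and mult: "\<And>x f. x \<in> W \<Longrightarrow> f * x \<in> W"
    and shift: "\<And>x. x \<in> W \<Longrightarrow> pcompose x [:c, 1:] \<in> W"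
  shows "W = UNIV"
proof -
  obtain w where w: "w \<in> W" "w \<noteq> 0"
    and min: "\<And>y. y \<in> W \<Longrightarrow> y \<noteq> 0 \<Longrightarrow> degree w \<le> degree y"
    using arg_min_nat_lemma[of "\<lambda>y. y \<in> W \<and> y \<noteq> 0" w0 degree] W0 by blast
  have "degree w = 0"
  proof (rule ccontr)
    assume "degree w \<noteq> 0"
    then have "degree (pcompose w [:c, 1:] - w) < degree w"
      by (simp add: degree_shift_diff_less)
    moreover have "pcompose w [:c, 1:] - w \<in> W" using w diff shift by blast
    ultimately have "pcompose w [:c, 1:] = w" using min by (metis eq_iff_diff_eq_0 not_less)
    then have "degree w = 0" using c by (rule shift_invariant_imp_constant)
    with \<open>degree w \<noteq> 0\<close> show False ..
  qed
  then obtain k where k: "w = [:k:]" by (rule degree_eq_zeroE)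
  have "f \<in> W" for f
  proof -
    have "f = smult (1 / k) f * w" using w k by simp
    also have "\<dots> \<in> W" using w(1) by (rule mult)
    finally show ?thesis .
  qed
  then show ?thesis by auto
qed


section \<open>The modules with underlying space \<open>\<complex>[s]\<close>\<close>

text \<open>
  All six families have this form, so that each claim about them needs to be proved only once.
\<close>

definition rank_one_act ::
    "complex poly \<Rightarrow> complex poly \<Rightarrow> complex \<Rightarrow> H4 \<Rightarrow> complex poly \<Rightarrow> complex poly" where
  "rank_one_act A B c = H4_act (\<lambda>x. tau x * A) (\<lambda>x. tau_inv x * B) (\<lambda>x. smult c x)"

text \<open>
  The relation \<open>[p,q] = r\<close>, evaluated at the polynomial \<open>1\<close>.
\<close>

definition compatible :: "complex poly \<Rightarrow> complex poly \<Rightarrow> complex \<Rightarrow> bool" where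
  "compatible A B c \<longleftrightarrow> A * tau B - B * tau_inv A = [:c:]"

lemma compatible_degenerate:
  "compatible g 0 0" "compatible 0 g 0" "compatible [:a:] [:b:] 0"
  by (simp_all add: compatible_def)

lemma M_as_rank_one_act:
  "M_g0 g = rank_one_act g 0 0"
  "M_0g g = rank_one_act 0 g 0"
  "M_hb h b = rank_one_act h [:b:] (- coeff h 1 * b)"
  "M_bh b h = rank_one_act [:b:] h (- coeff h 1 * b)"
  "M_ab a b = rank_one_act [:a:] [:b:] 0"
  "M_0 = rank_one_act 0 0 0"
  by (simp_all add: rank_one_act_def M_g0_def M_0g_def M_hb_def M_bh_def M_ab_def M_0_def)

lemma vector_space_smult: "vector_space (smult :: 'a::field \<Rightarrow> 'a poly \<Rightarrow> 'a poly)"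
  by unfold_locales (simp_all add: smult_add_right smult_add_left)

lemma rank_one_act_generators:
  "rank_one_act A B c H4_p x = tau x * A" "rank_one_act A B c H4_q x = tau_inv x * B"
  "rank_one_act A B c H4_r x = smult c x" "rank_one_act A B c H4_s x = [:0, 1:] * x"
  by (simp_all only: rank_one_act_def H4_act_generators)

text \<open>
  By the commutation rules of the three operators \<open>\<tau>(\<cdot>)A\<close>, \<open>\<tau>\<^bsup>-1\<^esup>(\<cdot>)B\<close> and multiplication by \<open>s\<close>,
  the bracket identity is a matter of collecting terms; compatibility is what makes the commutator
  of the first two equal to the scalar \<open>c\<close>.
\<close>

lemma H4_module_rank_one_act:
  assumes "compatible A B c"
  shows "H4_module smult (rank_one_act A B c)"
proof -
  interpret L: lie_algebra "(*s)" H4_bracket by (rule lie_algebra_H4)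
  interpret V: vector_space "smult :: complex \<Rightarrow> _" by (rule vector_space_smult)
  define P where "P x = tau x * A" for x
  define Q where "Q x = tau_inv x * B" for x
  define S where "S x = [:0, 1:] * x" for x :: "complex poly"
  have lin:
    "P (x + y) = P x + P y" "Q (x + y) = Q x + Q y" "S (x + y) = S x + S y"
    "P (smult k x) = smult k (P x)" "Q (smult k x) = smult k (Q x)" "S (smult k x) = smult k (S x)"
    for x y k
    by (simp_all add: P_def Q_def S_def distrib_right smult_add_right)
  have "P (Q x) - Q (P x) = x * (A * tau B - B * tau_inv A)" for x
    by (simp add: P_def Q_def algebra_simps)
  then have PQ: "P (Q x) = Q (P x) + smult c x" for x
    using assms by (simp add: compatible_def algebra_simps)
  have S: "P (S x) = S (P x) - P x" "Q (S x) = S (Q x) + Q x" for x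
    by (simp_all add: P_def Q_def S_def algebra_simps)
  have act: "rank_one_act A B c z x = smult (z$1) (P x) + smult (z$2) (Q x)
      + smult (z$3 * c) x + smult (z$4) (S x)" for z x
    by (simp add: rank_one_act_def H4_act_def P_def Q_def S_def)
  show ?thesis
  proof unfold_locales
    fix x y :: H4 and v
    show "rank_one_act A B c (H4_bracket x y) v =
      rank_one_act A B c x (rank_one_act A B c y v) - rank_one_act A B c y (rank_one_act A B c x v)"
      unfolding act
      by (simp add: lin PQ S H4_bracket_def H4_basis_defs axis_def smult_add_right smult_add_left
        smult_diff_right smult_diff_left algebra_simps)
  qed (simp_all add: act lin smult_add_right smult_add_left algebra_simps)
qed

text \<open>
  On these modules the restriction to \<open>\<complex>[s]\<close> is the regular module, for which \<open>1\<close> is a basis.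
\<close>

lemma Uh_scale_rank_one_act: "Uh_scale smult (rank_one_act A B c) f v = f * v"
proof -
  have "(rank_one_act A B c H4_s ^^ i) v = monom 1 i * v" for i
    by (induction i) (simp_all add: rank_one_act_generators monom_Suc)
  then show ?thesis
    by (simp add: Uh_scale_def smult_monom poly_as_sum_of_monoms flip: mult_smult_left sum_distrib_right)
qed

lemma in_M_rank_one_act:
  assumes "compatible A B c"
  shows "in_M_H4_h smult (rank_one_act A B c)"
proof -
  have scale: "Uh_scale smult (rank_one_act A B c) = (*)"
    by (intro ext Uh_scale_rank_one_act)
  interpret M: module "(*) :: complex poly \<Rightarrow> _"
    by unfold_locales (simp_all add: algebra_simps)
  have "\<not> M.dependent {1}" 
    by (auto simp: M.dependent_explicit subset_singleton_iff)
  moreover have "M.span {1} = UNIV"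
    by (auto simp: M.span_singleton)
  ultimately show ?thesis
    unfolding in_M_H4_h_def free_of_rank_one_def scale
    using H4_module_rank_one_act[OF assms] M.module_axioms by blast
qed


section \<open>Irreducibility\<close>

text \<open>
  Closure under \<open>s\<close> makes a submodule an ideal; \<open>p\<close> and \<open>q\<close> add the last two closure properties.
\<close>

lemma rank_one_submodule_ideal:
  assumes "lie_submodule smult (rank_one_act A B c) W"
  shows "0 \<in> W" "x \<in> W \<Longrightarrow> y \<in> W \<Longrightarrow> x - y \<in> W" "x \<in> W \<Longrightarrow> f * x \<in> W"
    "x \<in> W \<Longrightarrow> smult k x \<in> W" "x \<in> W \<Longrightarrow> tau x * A \<in> W" "x \<in> W \<Longrightarrow> tau_inv x * B \<in> W"
proof -
  interpret V: vector_space "smult :: complex \<Rightarrow> _" by (rule vector_space_smult)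
  have sub: "V.subspace W" and act: "\<And>z w. w \<in> W \<Longrightarrow> rank_one_act A B c z w \<in> W"
    using assms by (auto simp: lie_submodule_def)
  show "0 \<in> W" "x \<in> W \<Longrightarrow> y \<in> W \<Longrightarrow> x - y \<in> W" "x \<in> W \<Longrightarrow> smult k x \<in> W"
    using sub by (auto intro: V.subspace_0 V.subspace_diff V.subspace_scale)
  show "x \<in> W \<Longrightarrow> tau x * A \<in> W" "x \<in> W \<Longrightarrow> tau_inv x * B \<in> W"
    using act[of x H4_p] act[of x H4_q] by (simp_all add: rank_one_act_generators)
  show "f * x \<in> W" if x: "x \<in> W"
  proof (induction f)
    case 0
    then show ?case using V.subspace_0[OF sub] by simp
  next
    case (pCons a f)
    have "[:0, 1:] * (f * x) \<in> W"
      using act[OF pCons.IH, of H4_s] by (simp only: rank_one_act_generators)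
    then have "smult a x + [:0, 1:] * (f * x) \<in> W"
      using V.subspace_add[OF sub] V.subspace_scale[OF sub x] by blast
    then show ?case by simp
  qed
qed

text \<open>
  A nonzero constant \<open>A\<close> or \<open>B\<close> can be divided out of the action of \<open>p\<close> or \<open>q\<close>, which leaves a
  pure shift: by \<open>-1\<close> in the first case, by \<open>1\<close> in the second.
\<close>

lemma rank_one_irreducible:
  assumes "compatible A B c"
    and const: "k \<noteq> 0" "A = [:k:] \<or> B = [:k:]"
  shows "H4_irreducible smult (rank_one_act A B c)"
  unfolding H4_irreducible_def
proof (intro conjI allI impI)
  show "H4_module smult (rank_one_act A B c)" using assms(1) by (rule H4_module_rank_one_act)
  show "(UNIV :: complex poly set) \<noteq> {0}" using one_neq_zero by blast
  fix W assume W: "lie_submodule smult (rank_one_act A B c) W"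
  note ideal = rank_one_submodule_ideal[OF W]
  show "W = {0} \<or> W = UNIV"
  proof (cases "W = {0}")
    case False
    then obtain w where w: "w \<in> W" "w \<noteq> 0" using ideal(1) by blast
    have "\<exists>d. d \<noteq> 0 \<and> (\<forall>x\<in>W. pcompose x [:d, 1:] \<in> W)"
      using const(2)
    proof
      assume "A = [:k:]"
      then have "tau x \<in> W" if "x \<in> W" for x
        using ideal(4)[OF ideal(5)[OF that], of "1 / k"] const(1) by simp
      then show ?thesis by (intro exI[of _ "- 1"]) (simp add: tau_def)
    next
      assume "B = [:k:]"
      then have "tau_inv x \<in> W" if "x \<in> W" for x
        using ideal(4)[OF ideal(6)[OF that], of "1 / k"] const(1) by simp
      then show ?thesis by (intro exI[of _ 1]) (simp add: tau_inv_def)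
    qed
    then have "W = UNIV" using shift_closed_ideal_trivial[of _ w W] w ideal(2,3) by metis
    then show ?thesis ..
  qed simp
qed

text \<open>
  The ideal \<open>(d)\<close> is a submodule: \<open>p\<close> and \<open>q\<close> map all of \<open>\<complex>[s]\<close> into \<open>(A)\<close> and \<open>(B)\<close>, hence into
  \<open>(d)\<close>, while \<open>r\<close> and \<open>s\<close> preserve every ideal.
\<close>

lemma rank_one_reducible:
  assumes "d dvd A" "d dvd B" "d \<noteq> 0" "\<not> is_unit d"
  shows "\<not> H4_irreducible smult (rank_one_act A B c)"
proof
  assume irr: "H4_irreducible smult (rank_one_act A B c)"
  interpret V: vector_space "smult :: complex \<Rightarrow> _" by (rule vector_space_smult)
  define W where "W = {x. d dvd x}"
  have "V.subspace W"
    by (auto simp: W_def V.subspace_def dvd_smult)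
  moreover have "rank_one_act A B c z w \<in> W" if "w \<in> W" for z w
    using that assms(1,2) unfolding W_def rank_one_act_def H4_act_def mem_Collect_eq
    by (intro dvd_add dvd_smult dvd_mult)
  ultimately have "lie_submodule smult (rank_one_act A B c) W" by (simp add: lie_submodule_def)
  then have "W = {0} \<or> W = UNIV" using irr by (auto simp: H4_irreducible_def)
  moreover have "d \<in> W" "1 \<notin> W" using assms(4) by (auto simp: W_def)
  ultimately show False using assms(3) by auto
qed

text \<open>
  A nonconstant \<open>g\<close> serves as its own divisor; for \<open>g = 0\<close> the polynomial \<open>s\<close> does.
\<close>

lemma exists_nonunit_divisor:
  fixes g :: "complex poly"
  assumes "\<not> (\<exists>c. c \<noteq> 0 \<and> g = [:c:])"
  obtains d where "d dvd g" "d \<noteq> 0" "\<not> is_unit d"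
proof (cases "g = 0")
  case True
  then show thesis using that[of "[:0, 1:]"] by (simp add: is_unit_iff_degree)
next
  case False
  then have "degree g \<noteq> 0" using assms by (metis degree_eq_zeroE pCons_0_0)
  then show thesis using that[of g] False by (simp add: is_unit_iff_degree)
qed

lemma M_g0_irreducible_iff:
  "H4_irreducible smult (M_g0 g) \<longleftrightarrow> (\<exists>c. c \<noteq> 0 \<and> g = [:c:])"
proof
  assume irr: "H4_irreducible smult (M_g0 g)"
  show "\<exists>c. c \<noteq> 0 \<and> g = [:c:]"
  proof (rule ccontr)
    assume "\<not> ?thesis"
    then obtain d where "d dvd g" "d \<noteq> 0" "\<not> is_unit d" by (rule exists_nonunit_divisor)
    then show False
      using rank_one_reducible[of d g 0 0] irr by (simp add: M_as_rank_one_act)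
  qed
next
  assume "\<exists>c. c \<noteq> 0 \<and> g = [:c:]"
  then obtain c where "c \<noteq> 0" "g = [:c:]" by blast
  then show "H4_irreducible smult (M_g0 g)"
    unfolding M_as_rank_one_act
    by (intro rank_one_irreducible[OF compatible_degenerate(1), where k = c]) simp_all
qed

lemma M_0g_irreducible_iff:
  "H4_irreducible smult (M_0g g) \<longleftrightarrow> (\<exists>c. c \<noteq> 0 \<and> g = [:c:])"
proof
  assume irr: "H4_irreducible smult (M_0g g)"
  show "\<exists>c. c \<noteq> 0 \<and> g = [:c:]"
  proof (rule ccontr)
    assume "\<not> ?thesis"
    then obtain d where "d dvd g" "d \<noteq> 0" "\<not> is_unit d" by (rule exists_nonunit_divisor)
    then show False
      using rank_one_reducible[of d 0 g 0] irr by (simp add: M_as_rank_one_act)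
  qed
next
  assume "\<exists>c. c \<noteq> 0 \<and> g = [:c:]"
  then obtain c where "c \<noteq> 0" "g = [:c:]" by blast
  then show "H4_irreducible smult (M_0g g)"
    unfolding M_as_rank_one_act
    by (intro rank_one_irreducible[OF compatible_degenerate(2), where k = c]) simp_all
qed


section \<open>Compatible pairs of polynomials\<close>

lemma degree_oneE:
  fixes h :: "'a::comm_ring_1 poly"
  assumes "degree h = 1"
  obtains a b where "h = [:b, a:]" "a \<noteq> 0"
proof (cases h)
  case (pCons b k)
  then have "k \<noteq> 0" "degree k = 0" using assms by (auto split: if_splits)
  then show thesis using that pCons by (metis degree_eq_zeroE pCons_0_0)
qed

lemma compatible_linear_constant:
  assumes "degree h = 1"
  shows "compatible h [:b:] (- coeff h 1 * b)" "compatible [:b:] h (- coeff h 1 * b)"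
proof -
  obtain k l where "h = [:l, k:]" using assms by (rule degree_oneE)
  then show "compatible h [:b:] (- coeff h 1 * b)" "compatible [:b:] h (- coeff h 1 * b)"
    by (simp_all add: compatible_def algebra_simps)
qed

text \<open>
  Compatibility says that \<open>F = A\<tau>(B)\<close> changes by the constant \<open>c\<close> under a shift, so \<open>F\<close> is an
  affine function with slope \<open>-c\<close>. When \<open>F\<close> does not vanish, the cases are the ways of distributing
  its degree over the two factors.
\<close>

lemma compatible_cases:
  assumes "compatible A B c"
  obtains "B = 0" "c = 0"
  | "A = 0" "c = 0"
  | b where "degree A = 1" "b \<noteq> 0" "B = [:b:]" "c = - coeff A 1 * b"
  | b where "degree B = 1" "b \<noteq> 0" "A = [:b:]" "c = - coeff B 1 * b"
  | a b where "a \<noteq> 0" "b \<noteq> 0" "A = [:a:]" "B = [:b:]" "c = 0"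
proof (cases "A = 0 \<or> B = 0")
  case True
  then have "c = 0" using assms by (auto simp: compatible_def)
  then show thesis using True that(1,2) by blast
next
  case False
  define F where "F = A * tau B"
  \<comment> \<open>The linear term compensates the change of \<open>F\<close>, so that \<open>G\<close> is shift invariant.\<close>
  define G where "G = F + smult c [:0, 1:]"
  have "F - tau_inv F = [:c:]"
    using assms by (simp add: F_def compatible_def mult.commute)
  then have "tau_inv F = F - [:c:]" by (simp add: algebra_simps)
  then have "tau_inv G = G" by (simp add: G_def)
  then have "degree G = 0"
    using shift_invariant_imp_constant[of G 1] by (simp add: tau_inv_def)
  then obtain k where k: "G = [:k:]" by (rule degree_eq_zeroE)
  then have "F = [:k, - c:]" by (simp add: G_def eq_diff_eq[symmetric])
  then have "degree F \<le> 1" by simp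
  then have "degree A + degree B \<le> 1"
    using False by (simp add: F_def degree_mult_eq)
  then consider "degree A = 0" "degree B = 0" | "degree A = 1" "degree B = 0"
    | "degree A = 0" "degree B = 1" by linarith
  then show thesis
  proof cases
    case 1
    then obtain a b where ab: "A = [:a:]" "B = [:b:]" by (meson degree_eq_zeroE)
    then show thesis using that(5)[of a b] False assms by (simp add: compatible_def)
  next
    case 2
    then obtain b where b: "B = [:b:]" by (meson degree_eq_zeroE)
    then have "c = - coeff A 1 * b"
      using compatible_linear_constant(1)[OF 2(1), of b] assms by (simp add: compatible_def)
    then show thesis using that(3)[of b] 2 b False by simp
  next
    case 3
    then obtain b where b: "A = [:b:]" by (meson degree_eq_zeroE)
    then have "c = - coeff B 1 * b"
      using compatible_linear_constant(2)[OF 3(2), of b] assms by (simp add: compatible_def)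
    then show thesis using that(4)[of b] 3 b False by simp
  qed
qed


section \<open>Modules that are free of rank one over \<open>\<complex>[s]\<close>\<close>

lemma H4_expand:
  fixes z :: H4
  shows "z = z$1 *s H4_p + z$2 *s H4_q + z$3 *s H4_r + z$4 *s H4_s"
  by (simp add: H4_basis_defs vec_eq_iff forall_4 axis_def)

text \<open>
  The isomorphism is the inverse of \<open>\<psi> f = f.v\<close>, where \<open>v\<close> is a basis of the restriction to
  \<open>\<complex>[s]\<close>. That \<open>r\<close> acts by a scalar comes from \<open>[p,r] = 0\<close> if \<open>A \<noteq> 0\<close>, and from \<open>[p,q] = r\<close> if
  \<open>A = 0\<close>.
\<close>

lemma in_M_imp_rank_one_act:
  fixes scl :: "complex \<Rightarrow> 'v::ab_group_add \<Rightarrow> 'v"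
  assumes "in_M_H4_h scl act"
  obtains A B c where "compatible A B c" "module_isomorphic scl act smult (rank_one_act A B c)"
proof -
  interpret lie_module "(*s)" H4_bracket scl act
    using assms by (simp add: in_M_H4_h_def)
  interpret U: module "Uh_scale scl act"
    using assms by (simp add: in_M_H4_h_def free_of_rank_one_def)
  interpret P: vector_space "smult :: complex \<Rightarrow> _" by (rule vector_space_smult)
  obtain v where indep: "\<not> U.dependent {v}" and span: "U.span {v} = UNIV"
    using assms by (auto simp: in_M_H4_h_def free_of_rank_one_def)
  define \<psi> where "\<psi> f = Uh_scale scl act f v" for f
  interpret right: Vector_Spaces.linear scl scl "act z" for z by (rule act_linear_right)
  interpret left: Vector_Spaces.linear "(*s)" scl "\<lambda>z. act z w" for w by (rule act_linear_left)
  have \<psi>_add: "\<psi> (f + g) = \<psi> f + \<psi> g" for f g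
    by (simp add: \<psi>_def U.scale_left_distrib)
  have \<psi>_diff: "\<psi> (f - g) = \<psi> f - \<psi> g" for f g
    by (simp add: \<psi>_def U.scale_left_diff_distrib)
  have Uh_const: "Uh_scale scl act [:k:] w = scl k w" for k w
    by (simp add: Uh_scale_def)
  have \<psi>_smult: "\<psi> (smult k f) = scl k (\<psi> f)" for k f
    using U.scale_scale[of "[:k:]" f v] unfolding \<psi>_def Uh_const by simp
  have Uh_s: "Uh_scale scl act [:0, 1:] w = act H4_s w" for w
    by (simp add: Uh_scale_def)
  have \<psi>_s: "\<psi> ([:0, 1:] * f) = act H4_s (\<psi> f)" for f
    using U.scale_scale[of "[:0, 1:]" f v] unfolding \<psi>_def Uh_s by simp
  have \<psi>_0: "\<psi> 0 = 0" by (simp add: \<psi>_def)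
  have \<psi>_ker: "f = 0" if "\<psi> f = 0" for f
  proof (rule ccontr)
    assume "f \<noteq> 0"
    then have "U.dependent {v}"
      unfolding U.dependent_explicit using that
      by (intro exI[of _ "{v}"] exI[of _ "\<lambda>_. f"]) (simp add: \<psi>_def)
    with indep show False ..
  qed
  have "inj \<psi>"
    by (rule injI) (metis \<psi>_diff \<psi>_ker eq_iff_diff_eq_0)
  moreover have "surj \<psi>"
    using span unfolding U.span_singleton \<psi>_def by simp
  ultimately have "bij \<psi>" by (simp add: bij_def)
  \<comment> \<open>An eigenvector \<open>z\<close> of \<open>ad s\<close> with eigenvalue \<open>-k\<close> satisfies \<open>zs = (s + k)z\<close>, so it passes
    a polynomial in \<open>s\<close> by replacing \<open>s\<close> with \<open>s + k\<close>.\<close>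
  have shift: "act z (\<psi> f) = \<psi> (pcompose f [:k, 1:] * inv \<psi> (act z v))"
    if comm: "\<And>w. act z (act H4_s w) = act H4_s (act z w) + scl k (act z w)" for z k f
  proof (induction f)
    case 0
    then show ?case by (simp add: \<psi>_0 right.zero)
  next
    case (pCons a f)
    define g where "g = inv \<psi> (act z v)"
    have "\<psi> 1 = v" by (simp add: \<psi>_def)
    have g: "\<psi> g = act z v" using \<open>surj \<psi>\<close> by (simp add: g_def surj_f_inv_f)
    have "\<psi> (pCons a f) = scl a v + act H4_s (\<psi> f)"
      using \<psi>_add[of "smult a 1" "[:0, 1:] * f"] \<psi>_smult[of a 1] \<psi>_s[of f] \<open>\<psi> 1 = v\<close> by simp
    then have "act z (\<psi> (pCons a f)) =
        scl a (\<psi> g) + (act H4_s (act z (\<psi> f)) + scl k (act z (\<psi> f)))"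
      by (simp add: right.add right.scale comm g)
    also have "\<dots> = \<psi> (smult a g + ([:0, 1:] * (pcompose f [:k, 1:] * g)
        + smult k (pcompose f [:k, 1:] * g)))"
      by (simp only: \<psi>_add \<psi>_smult \<psi>_s pCons.IH[folded g_def])
    also have "smult a g + ([:0, 1:] * (pcompose f [:k, 1:] * g)
        + smult k (pcompose f [:k, 1:] * g)) = pcompose (pCons a f) [:k, 1:] * g"
      by (simp add: pcompose_pCons algebra_simps)
    finally show ?case by (simp add: g_def)
  qed
  define A where "A = inv \<psi> (act H4_p v)"
  define B where "B = inv \<psi> (act H4_q v)"
  define R where "R = inv \<psi> (act H4_r v)"
  have "H4_bracket H4_s H4_r = 0" "H4_bracket H4_p H4_r = 0"
    by (simp_all add: H4_bracket_def H4_basis_defs vec_eq_iff forall_4 axis_def)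
  note brackets = H4_brackets this
  \<comment> \<open>The shifts for \<open>p\<close>, \<open>q\<close>, \<open>r\<close> are \<open>-1\<close>, \<open>1\<close>, \<open>0\<close>, the negatives of their weights.\<close>
  have P: "act H4_p (\<psi> f) = \<psi> (tau f * A)" for f
    unfolding A_def tau_def
    using act_bracket[of H4_s H4_p] by (intro shift) (simp add: brackets algebra_simps)
  have Q: "act H4_q (\<psi> f) = \<psi> (tau_inv f * B)" for f
    unfolding B_def tau_inv_def
    using act_bracket[of H4_s H4_q] by (intro shift) (simp add: brackets left.neg algebra_simps)
  have Rf: "act H4_r (\<psi> f) = \<psi> (f * R)" for f
    using shift[of H4_r 0 f] act_bracket[of H4_s H4_r]
    by (simp add: brackets left.zero R_def)
  have \<psi>_eq: "\<psi> f = \<psi> g \<longleftrightarrow> f = g" for f g using \<open>inj \<psi>\<close> by (auto dest: injD)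
  have "\<psi> R = \<psi> (A * tau B - B * tau_inv A)"
    using act_bracket[of H4_p H4_q "\<psi> 1"]
    by (simp add: brackets P Q Rf \<psi>_diff mult.commute)
  then have R: "R = A * tau B - B * tau_inv A" by (simp only: \<psi>_eq)
  have "\<psi> (A * tau R) = \<psi> (A * R)"
    using act_bracket[of H4_p H4_r "\<psi> 1"]
    by (simp add: brackets left.zero P Rf mult.commute)
  then have "A * tau R = A * R" by (simp only: \<psi>_eq)
  have "degree R = 0"
  proof (cases "A = 0")
    case True
    then show ?thesis by (simp add: R)
  next
    case False
    then have "tau R = R" using \<open>A * tau R = A * R\<close> by simp
    then show ?thesis using shift_invariant_imp_constant[of R "-1"] by (simp add: tau_def)
  qed
  then obtain c where c: "R = [:c:]" by (rule degree_eq_zeroE)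
  have act_\<psi>: "act z (\<psi> f) = \<psi> (rank_one_act A B c z f)" for z f
  proof -
    have "act z (\<psi> f) = scl (z$1) (act H4_p (\<psi> f)) + scl (z$2) (act H4_q (\<psi> f))
        + scl (z$3) (act H4_r (\<psi> f)) + scl (z$4) (act H4_s (\<psi> f))"
      by (subst H4_expand[of z])
        (simp only: left.add left.scale)
    also have "\<dots> = \<psi> (rank_one_act A B c z f)"
      unfolding P Q Rf c \<psi>_s[symmetric] \<psi>_smult[symmetric] \<psi>_add[symmetric]
      by (simp add: rank_one_act_def H4_act_def)
    finally show ?thesis .
  qed
  have "module_isomorphic scl act smult (rank_one_act A B c)"
    unfolding module_isomorphic_def
  proof (intro exI[of _ "inv \<psi>"] conjI allI)
    show "bij (inv \<psi>)" using \<open>bij \<psi>\<close> by (rule bij_imp_bij_inv)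
    have inv: "inv \<psi> w = f \<longleftrightarrow> w = \<psi> f" for w f
      using \<open>bij \<psi>\<close> by (metis bij_inv_eq_iff)
    have inv': "\<psi> (inv \<psi> w) = w" for w using \<open>surj \<psi>\<close> by (simp add: surj_f_inv_f)
    show "Vector_Spaces.linear scl smult (inv \<psi>)"
      by unfold_locales (simp_all add: inv inv' \<psi>_add \<psi>_smult)
    show "inv \<psi> (act z w) = rank_one_act A B c z (inv \<psi> w)" for z w
      by (simp add: inv inv' flip: act_\<psi>)
  qed
  moreover have "compatible A B c" using R c by (simp add: compatible_def)
  ultimately show thesis by (rule that[rotated])
qed


section \<open>The classification\<close>

theorem theorem1p1:
  shows
    "((\<forall>g. in_M_H4_h smult (M_g0 g)) \<and>
      (\<forall>g. in_M_H4_h smult (M_0g g)) \<and>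
      (\<forall>h b. degree h = 1 \<and> b \<noteq> 0 \<longrightarrow> in_M_H4_h smult (M_hb h b)) \<and>
      (\<forall>h b. degree h = 1 \<and> b \<noteq> 0 \<longrightarrow> in_M_H4_h smult (M_bh b h)) \<and>
      (\<forall>a b. a \<noteq> 0 \<and> b \<noteq> 0 \<longrightarrow> in_M_H4_h smult (M_ab a b)) \<and>
      in_M_H4_h smult M_0 \<and>
      (\<forall>(scl :: complex \<Rightarrow> 'v::ab_group_add \<Rightarrow> 'v) act.
         in_M_H4_h scl act \<longrightarrow>
           (\<exists>g. module_isomorphic scl act smult (M_g0 g)) \<or>
           (\<exists>g. module_isomorphic scl act smult (M_0g g)) \<or>
           (\<exists>h b. degree h = 1 \<and> b \<noteq> 0 \<and> module_isomorphic scl act smult (M_hb h b)) \<or>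
           (\<exists>h b. degree h = 1 \<and> b \<noteq> 0 \<and> module_isomorphic scl act smult (M_bh b h)) \<or>
           (\<exists>a b. a \<noteq> 0 \<and> b \<noteq> 0 \<and> module_isomorphic scl act smult (M_ab a b)) \<or>
           module_isomorphic scl act smult M_0))
     \<and>
     ((\<forall>g. H4_irreducible smult (M_g0 g) \<longleftrightarrow> (\<exists>c. c \<noteq> 0 \<and> g = [:c:])) \<and>
      (\<forall>g. H4_irreducible smult (M_0g g) \<longleftrightarrow> (\<exists>c. c \<noteq> 0 \<and> g = [:c:])))
     \<and>
     (\<forall>a b h. a \<noteq> 0 \<and> b \<noteq> 0 \<and> degree h = 1 \<longrightarrow>
        H4_irreducible smult (M_hb h b) \<and>
        H4_irreducible smult (M_bh b h) \<and>
        H4_irreducible smult (M_ab a b))"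
proof -
  have rank_one:
    "(\<exists>g. module_isomorphic scl act smult (M_g0 g)) \<or>
     (\<exists>g. module_isomorphic scl act smult (M_0g g)) \<or>
     (\<exists>h b. degree h = 1 \<and> b \<noteq> 0 \<and> module_isomorphic scl act smult (M_hb h b)) \<or>
     (\<exists>h b. degree h = 1 \<and> b \<noteq> 0 \<and> module_isomorphic scl act smult (M_bh b h)) \<or>
     (\<exists>a b. a \<noteq> 0 \<and> b \<noteq> 0 \<and> module_isomorphic scl act smult (M_ab a b)) \<or>
     module_isomorphic scl act smult M_0"
    if in_M: "in_M_H4_h scl act" for scl :: "complex \<Rightarrow> 'v \<Rightarrow> 'v" and act
  proof -
    obtain A B c where comp: "compatible A B c"
      and iso: "module_isomorphic scl act smult (rank_one_act A B c)"
      using in_M_imp_rank_one_act[OF in_M] .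
    show ?thesis
      using comp by (cases rule: compatible_cases) (use iso in \<open>auto simp: M_as_rank_one_act\<close>)
  qed
  note comp = compatible_degenerate compatible_linear_constant
  have irr1: "H4_irreducible smult (M_hb h b)" "H4_irreducible smult (M_bh b h)"
    if "degree h = 1" "b \<noteq> 0" for h b
    unfolding M_as_rank_one_act
    by (rule rank_one_irreducible[OF comp(4)[OF that(1)] that(2) disjI2[OF refl]],
        rule rank_one_irreducible[OF comp(5)[OF that(1)] that(2) disjI1[OF refl]])
  have irr2: "H4_irreducible smult (M_ab a b)" if "b \<noteq> 0" for a b
    unfolding M_as_rank_one_act by (rule rank_one_irreducible[OF comp(3) that disjI2[OF refl]])
  have mem1: "in_M_H4_h smult (M_hb h b)" "in_M_H4_h smult (M_bh b h)"
    if "degree h = 1" for h b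
    unfolding M_as_rank_one_act by (rule in_M_rank_one_act comp that)+
  have mem2: "in_M_H4_h smult (M_g0 g)" "in_M_H4_h smult (M_0g g)"
    "in_M_H4_h smult (M_ab a b)" "in_M_H4_h smult M_0" for g a b
    unfolding M_as_rank_one_act by (rule in_M_rank_one_act comp)+
  show ?thesis
    by (intro conjI allI impI; (elim conjE)?;
        rule mem1 mem2 rank_one irr1 irr2 M_g0_irreducible_iff M_0g_irreducible_iff; assumption)
qed

end
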